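(* Let $\phi(a,b,c,d)=a^2bc+abc^2+ac^2d+acd^2+b^2cd+bc^2d$. For arbitrary parameters $p,q,r,s$, define \[ \begin{aligned} x_1&=\phi(p,q,r,s), & x_2&=\phi(p,r,s,q), & x_3&=\phi(p,s,q,r), & x_4&=\phi(q,r,p,s),\\ y_1&=\phi(p,q,s,r), & y_2&=\phi(p,r,q,s), & y_3&=\phi(p,s,r,q), & y_4&=\phi(q,s,p,r). \end{aligned} \] Then \[ x_1^j+x_2^j+x_3^j+x_4^j=y_1^j+y_2^j+y_3^j+y_4^j \quad\text{for } j=1,2,3. \]
   Context: Parameters $p,q,r,s$ are arbitrary integers (or rationals). *)

theory Defs
  imports Complex_Main
begin

definition \<phi> :: "rat \<Rightarrow> rat \<Rightarrow> rat \<Rightarrow> rat \<Rightarrow> rat" where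
  "\<phi> a b c d = a^2*b*c + a*b*c^2 + a*c^2*d + a*c*d^2 + b^2*c*d + b*c^2*d"

end

theory Submission
  imports Defs
begin

text \<open>\<open>\<phi>\<close> is invariant under the 3-cycle a -> b -> d -> a, so the
  \<open>x\<close>s are its images under the even permutations of p, q, r, s and the
  \<open>y\<close>s those under the odd ones. Each difference of power sums is thus alternating, of
  degree 4j; it vanishes identically.\<close>

theorem theorem3:
  fixes p q r s x\<^sub>1 x\<^sub>2 x\<^sub>3 x\<^sub>4 y\<^sub>1 y\<^sub>2 y\<^sub>3 y\<^sub>4 :: rat and j :: nat
  assumes "x\<^sub>1 = \<phi> p q r s" and "x\<^sub>2 = \<phi> p r s q"
    and "x\<^sub>3 = \<phi> p s q r" and "x\<^sub>4 = \<phi> q r p s"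
    and "y\<^sub>1 = \<phi> p q s r" and "y\<^sub>2 = \<phi> p r q s"
    and "y\<^sub>3 = \<phi> p s r q" and "y\<^sub>4 = \<phi> q s p r"
    and "j \<in> {1, 2, 3}"
  shows "x\<^sub>1^j + x\<^sub>2^j + x\<^sub>3^j + x\<^sub>4^j = y\<^sub>1^j + y\<^sub>2^j + y\<^sub>3^j + y\<^sub>4^j"
proof -
  consider "j = 1" | "j = 2" | "j = 3"
    using \<open>j \<in> {1, 2, 3}\<close> by blast
  then show ?thesis
  proof cases
    case 1
    \<comment> \<open>An alternating quartic is zero, as the Vandermonde product has degree
      6.\<close>
    show ?thesis unfolding 1 assms(1-8) \<phi>_def by algebra
  next
    case 2
    \<comment> \<open>Degree alone no longer suffices here or for cubes; expansion shows that all
      monomials cancel.\<close>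
    show ?thesis unfolding 2 assms(1-8) \<phi>_def by algebra
  next
    case 3
    show ?thesis unfolding 3 assms(1-8) \<phi>_def by algebra
  qed
qed

end
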